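(* For all $d\in\mathbb N$, $a\in\mathbb N_0$, $n\in\mathbb N_0$ and $m\in\mathbb N_0$, $$\sum_{j=0}^m (a+d\,j)^n=\frac{1}{d\,(n+1)}\Big[B(d;n+1,\,a+d(m+1))-B(d;n+1,\,d)-B(d;n+1,\,a)+B(d;n+1,\,0)+d\,\delta_{n,0}\Big].$$
   Context: $\mathbb N=\{1,2,\dots\}$, $\mathbb N_0=\{0,1,2,\dots\}$, and $0^0:=1$. $\delta_{n,0}$ is the Kronecker symbol ($1$ if $n=0$, else $0$). The Bernoulli numbers $B(n)$ are defined by $B(0)=1$ and $B(n)=-\frac1{n+1}\sum_{k=0}^{n-1}\binom{n+1}{k}B(k)$ for $n\ge 1$ (so $B(1)=-\tfrac12$). The generalized Bernoulli numbers are $B(d;n):=d^n\,B(n)$, and the generalized Bernoulli polynomials are $B(d;n,x):=\sum_{m=0}^n\binom{n}{m}B(d;n-m)\,x^m$. *)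

theory Defs
  imports Complex_Main
begin

fun bernoulli :: "nat \<Rightarrow> real" where
  "bernoulli n =
     (if n = 0 then 1
      else - (1 / real (n + 1)) * (\<Sum>k<n. real ((n + 1) choose k) * bernoulli k))"

(* The unconditional defining equation makes the simplifier loop. *)
declare bernoulli.simps [simp del]

definition gen_bernoulli :: "nat \<Rightarrow> nat \<Rightarrow> real" where
  "gen_bernoulli d n = real d ^ n * bernoulli n"

definition gen_bernpoly :: "nat \<Rightarrow> nat \<Rightarrow> real \<Rightarrow> real" where
  "gen_bernpoly d n x = (\<Sum>m=0..n. real (n choose m) * gen_bernoulli d (n - m) * x ^ m)"

end

(* B(d;N,x) is the Appell sequence of the numbers d^n B(n), so
   B(d;N,x+d) = sum_j (N choose j) B(d;N-j,d) x^j.  The Bernoulli recursion says that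
   B(d;k,d) = B(d;k,0) except for k = 1, where the difference is d.  Hence
   B(d;N,x+d) - B(d;N,x) = d N x^(N-1), and the sum telescopes.  The two terms at d and 0 differ
   by d for n = 0 (and not otherwise), so they cancel against the Kronecker term. *)
theory Submission
  imports Defs
begin

text \<open>For \<open>k = n + 1\<close> with n \<ge> 1, the top term has coefficient
  \<open>(n + 1) choose n\<close>, which is n + 1, so the recursion cleared of its denominator makes
  it cancel the rest.\<close>

lemma sum_binomial_bernoulli:
  "(\<Sum>i<k. real (k choose i) * bernoulli i) = (if k = 1 then 1 else 0)"
proof (cases k)
  case (Suc n)
  show ?thesis
  proof (cases "n = 0")
    case True
    then show ?thesis using Suc by (simp add: bernoulli.simps)
  next
    case False
    then have "real (n + 1) * bernoulli n = - (\<Sum>i<n. real ((n + 1) choose i) * bernoulli i)"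
      by (subst bernoulli.simps) simp
    then show ?thesis using Suc False by simp
  qed
qed simp

lemma gen_bernpoly_0 [simp]: "gen_bernpoly d n 0 = gen_bernoulli d n"
  by (simp add: gen_bernpoly_def atLeast0AtMost power_0_left if_distrib cong: if_cong)

lemma gen_bernpoly_add:
  "gen_bernpoly d N (x + y) = (\<Sum>j\<le>N. real (N choose j) * gen_bernpoly d (N - j) y * x ^ j)"
proof -
  let ?b = "gen_bernoulli d"
  have "gen_bernpoly d N (x + y) = (\<Sum>m\<le>N. \<Sum>j\<le>m.
      real (N choose m) * ?b (N - m) * (real (m choose j) * x ^ j * y ^ (m - j)))"
    by (simp add: gen_bernpoly_def atLeast0AtMost binomial_ring sum_distrib_left)
  also have "\<dots> = (\<Sum>j\<le>N. \<Sum>i\<le>N - j.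
      real (N choose j) * (real ((N - j) choose i) * ?b (N - j - i) * y ^ i) * x ^ j)"
    \<comment> \<open>Collecting by powers of x puts i = m - j; the coefficients agree by choosing
      the j-subset before the m-set that contains it.\<close>
    unfolding sum.Sigma[OF finite_atMost ballI[OF finite_atMost]]
  proof (rule sum.reindex_bij_witness[where i = "\<lambda>(j, i). (j + i, j)"
        and j = "\<lambda>(m, j). (j, m - j)"], goal_cases)
    case (5 p)
    then obtain m j where p: "p = (m, j)" and le: "j \<le> m" "m \<le> N" by auto
    have "real (N choose m) * real (m choose j) = real (N choose j) * real ((N - j) choose (m - j))"
      using choose_mult[OF le] by (metis of_nat_mult)
    then show ?case using p le by (simp add: mult_ac)
  qed auto
  also have "\<dots> = (\<Sum>j\<le>N. real (N choose j) * gen_bernpoly d (N - j) y * x ^ j)"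
    by (simp add: gen_bernpoly_def atLeast0AtMost sum_distrib_left sum_distrib_right)
  finally show ?thesis .
qed

text \<open>At x = d every term carries the same factor d^k. What remains is the recursion sum over
  i < k, nonzero only for k = 1, plus the term i = k.\<close>

lemma gen_bernpoly_period:
  "gen_bernpoly d k (real d) = gen_bernoulli d k + (if k = 1 then real d else 0)"
proof -
  have "gen_bernpoly d k (real d) =
      (\<Sum>m\<le>k. real d ^ k * (real (k choose (k - m)) * bernoulli (k - m)))"
    unfolding gen_bernpoly_def gen_bernoulli_def atLeast0AtMost
  proof (rule sum.cong[OF refl], goal_cases)
    case (1 m)
    then have "real d ^ k = real d ^ (k - m) * real d ^ m"
      by (simp flip: power_add)
    then show ?case using 1 by (simp flip: binomial_symmetric)
  qed
  also have "\<dots> = (\<Sum>i\<le>k. real d ^ k * (real (k choose i) * bernoulli i))"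
    by (rule sum.reindex_bij_witness[where i = "\<lambda>i. k - i" and j = "\<lambda>i. k - i"]) auto
  also have "\<dots> = real d ^ k * ((\<Sum>i<k. real (k choose i) * bernoulli i) + bernoulli k)"
    by (simp flip: lessThan_Suc_atMost sum_distrib_left)
  also have "\<dots> = gen_bernoulli d k + (if k = 1 then real d else 0)"
    unfolding sum_binomial_bernoulli by (simp add: gen_bernoulli_def algebra_simps)
  finally show ?thesis .
qed

lemma gen_bernpoly_diff:
  "gen_bernpoly d (n + 1) (x + real d) - gen_bernpoly d (n + 1) x = real d * real (n + 1) * x ^ n"
proof -
  let ?c = "\<lambda>j. real ((n + 1) choose j)"
  \<comment> \<open>Writing \<open>x + 0\<close> lets \<open>gen_bernpoly_add\<close> expand both
    polynomials in powers of x. Their coefficients come from the values at d and at 0, which differ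
    only for index \<open>n + 1 - j = 1\<close>, that is j = n.\<close>
  have "gen_bernpoly d (n + 1) (x + real d) - gen_bernpoly d (n + 1) (x + 0) =
      (\<Sum>j\<le>n + 1. ?c j * (if n + 1 - j = 1 then real d else 0) * x ^ j)"
    unfolding gen_bernpoly_add gen_bernpoly_period gen_bernpoly_0
    by (simp only: sum_subtractf[symmetric] algebra_simps) simp
  also have "\<dots> = (\<Sum>j\<le>n + 1. if j = n then ?c j * real d * x ^ j else 0)"
    by (rule sum.cong) auto
  also have "\<dots> = real d * real (n + 1) * x ^ n"
    by simp
  finally show ?thesis by simp
qed

theorem mainTheorem1:
  fixes d a n m :: nat
  assumes "d \<ge> 1"
  shows "(\<Sum>j=0..m. (real a + real d * real j) ^ n) =
    1 / (real d * real (n + 1)) *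
      (gen_bernpoly d (n + 1) (real a + real d * real (m + 1))
       - gen_bernpoly d (n + 1) (real d)
       - gen_bernpoly d (n + 1) (real a)
       + gen_bernpoly d (n + 1) 0
       + real d * (if n = 0 then 1 else 0))"
proof -
  let ?B = "gen_bernpoly d (n + 1)"
  let ?f = "\<lambda>j. ?B (real a + real d * real j)"
  \<comment> \<open>Scaled by d (n + 1), each power is the increment of \<open>?B\<close> from a + d
    j to a + d (j + 1).\<close>
  have "real d * real (n + 1) * (\<Sum>j=0..m. (real a + real d * real j) ^ n) =
      (\<Sum>j<m + 1. ?f (Suc j) - ?f j)"
    unfolding sum_distrib_left
  proof (rule sum.cong, goal_cases)
    case (2 j)
    have "real a + real d * real (Suc j) = real a + real d * real j + real d"
      by (simp add: algebra_simps)
    then show ?case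
      by (simp only: gen_bernpoly_diff)
  qed auto
  also have "\<dots> = ?f (m + 1) - ?B (real a)"
    using sum_lessThan_telescope[of ?f "m + 1"] by simp
  also have "\<dots> = ?f (m + 1) - ?B (real d) - ?B (real a) + ?B 0 + real d * (if n = 0 then 1 else 0)"
    by (simp add: gen_bernpoly_period)
  finally show ?thesis
    using assms by (simp add: field_simps del: of_nat_Suc)
qed

end
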